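(* Let $G$ be a connected amply regular graph with parameters $(n,d,\alpha,\beta)$ (with $n=\infty$ allowed), which is neither complete nor empty, and let $0<\varepsilon<1$ be a real number. If $\beta\ge\alpha>\varepsilon d\ge 1$, then the diameter of $G$ is at most $4/\varepsilon$.
   Context: All graphs are simple and undirected. An amply regular graph with parameters $(n,d,\alpha,\beta)$ is a $d$-regular graph ($d$ finite) with $n$ vertices, $n=\infty$ being allowed, such that any two adjacent vertices have exactly $\alpha$ common neighbors and any two vertices at distance $2$ have exactly $\beta$ common neighbors. The diameter is taken with respect to the combinatorial (shortest path) distance. *)

theory Defs
  imports
    "Graph_Theory.Shortest_Path"
    "Graph_Theory.Digraph_Component"
    "HOL-Library.Extended_Nat"
begin

text \<open>
  Simple undirected graphs, finite or infinite, are the symmetric loop-free arc relations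
  of locale \<^locale>\<open>pair_bidirected_digraph\<close>, each edge being present as two opposite arcs.
\<close>

abbreviation simple_graph :: "'a pair_pre_digraph \<Rightarrow> bool" where
  "simple_graph \<equiv> pair_bidirected_digraph"

definition graph_order :: "'a pair_pre_digraph \<Rightarrow> enat" where
  "graph_order G = (if finite (pverts G) then enat (card (pverts G)) else \<infinity>)"

definition common_neighbors :: "'a pair_pre_digraph \<Rightarrow> 'a \<Rightarrow> 'a \<Rightarrow> 'a set" where
  "common_neighbors G u v = {w \<in> pverts G. (u, w) \<in> parcs G \<and> (v, w) \<in> parcs G}"

text \<open>With unit weights the cost of a walk is its number of arcs.\<close>

definition graph_dist :: "'a pair_pre_digraph \<Rightarrow> 'a \<Rightarrow> 'a \<Rightarrow> ereal" where
  "graph_dist G u v = wf_digraph.\<mu> (with_proj G) (\<lambda>_. 1) u v"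

definition graph_diameter :: "'a pair_pre_digraph \<Rightarrow> ereal" where
  "graph_diameter G = (SUP u \<in> pverts G. SUP v \<in> pverts G. graph_dist G u v)"

text \<open>
  The finiteness condition is needed since \<^const>\<open>out_degree\<close> is \<open>0\<close> at vertices of
  infinite degree.
\<close>

definition regular_graph :: "'a pair_pre_digraph \<Rightarrow> nat \<Rightarrow> bool" where
  "regular_graph G d \<longleftrightarrow>
     (\<forall>v \<in> pverts G. finite (out_arcs (with_proj G) v) \<and> out_degree (with_proj G) v = d)"

definition amply_regular ::
  "'a pair_pre_digraph \<Rightarrow> enat \<Rightarrow> nat \<Rightarrow> nat \<Rightarrow> nat \<Rightarrow> bool" where
  "amply_regular G n d \<alpha> \<beta> \<longleftrightarrow>
     simple_graph G \<and> graph_order G = n \<and> regular_graph G d \<and>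
     (\<forall>u \<in> pverts G. \<forall>v \<in> pverts G. (u, v) \<in> parcs G \<longrightarrow> card (common_neighbors G u v) = \<alpha>) \<and>
     (\<forall>u \<in> pverts G. \<forall>v \<in> pverts G. graph_dist G u v = 2 \<longrightarrow> card (common_neighbors G u v) = \<beta>)"

definition complete_graph :: "'a pair_pre_digraph \<Rightarrow> bool" where
  "complete_graph G \<longleftrightarrow> (\<forall>u \<in> pverts G. \<forall>v \<in> pverts G. u \<noteq> v \<longrightarrow> (u, v) \<in> parcs G)"

text \<open>Empty means edgeless; vertices are allowed.\<close>

definition empty_graph :: "'a pair_pre_digraph \<Rightarrow> bool" where
  "empty_graph G \<longleftrightarrow> parcs G = {}"

end

theory Submission
  imports Defs
begin

text \<open>
  Fix a function that changes by at most one along each edge, such as the distance from a vertex,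
  and let \<open>c x\<close> and \<open>b x\<close> count the neighbors of \<open>x\<close> one level below and one level above it.
  Along an ascending edge \<open>z, m\<close>, each lower neighbor of \<open>z\<close> has \<open>\<beta> - 1\<close> common neighbors with
  \<open>m\<close> besides \<open>z\<close>, while each lower neighbor \<open>y \<noteq> z\<close> of \<open>m\<close> is adjacent to at most \<open>\<beta> - 1\<close>
  lower neighbors of \<open>z\<close>. Hence \<open>c m \<ge> c z + 1\<close>, and every common neighbor of \<open>y\<close> and \<open>z\<close>
  other than \<open>m\<close> which is not below \<open>z\<close> improves this by \<open>1 / (\<beta> - 1)\<close>. Dually,
  \<open>b m' \<ge> b z + 1\<close> for a lower neighbor \<open>m'\<close> of \<open>z\<close>. The \<open>\<beta> - 1\<close> common neighbors
  \<open>y \<noteq> z\<close> of \<open>m\<close> and \<open>m'\<close> occur in both counts, and a common neighbor of \<open>y\<close> and \<open>z\<close> cannot be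
  at once below and above \<open>z\<close>, so that together \<open>c m + b m' \<ge> c z + b z + \<alpha>\<close>.
  Summing along a geodesic of length \<open>D\<close> gives \<open>(D - 1) \<alpha> \<le> 2 d\<close>.
\<close>

section \<open>Levels of an integer function on a graph\<close>

text \<open>Levels are integers so that replacing \<open>f\<close> by \<open>- f\<close> exchanges
  \<open>lower\<close> and \<open>upper\<close>.\<close>

definition lower :: "('a \<Rightarrow> 'a set) \<Rightarrow> ('a \<Rightarrow> int) \<Rightarrow> 'a \<Rightarrow> 'a set" where
  "lower N f x = {y \<in> N x. f y = f x - 1}"

definition upper :: "('a \<Rightarrow> 'a set) \<Rightarrow> ('a \<Rightarrow> int) \<Rightarrow> 'a \<Rightarrow> 'a set" where
  "upper N f x = {y \<in> N x. f y = f x + 1}"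

lemma lower_uminus: "lower N (\<lambda>x. - f x) = upper N f"
  by (auto simp: lower_def upper_def fun_eq_iff)

text \<open>Double counting of the adjacent pairs between \<open>A\<close> and
  \<open>B\<close>.\<close>

lemma sum_card_Int_swap:
  assumes "finite A" "finite B" "\<And>x y. y \<in> N x \<Longrightarrow> x \<in> N y"
  shows "(\<Sum>x\<in>A. card (N x \<inter> B)) = (\<Sum>y\<in>B. card (N y \<inter> A))"
proof -
  have *: "card (N x \<inter> S) = (\<Sum>y\<in>S. if y \<in> N x then 1 else 0)" if "finite S" for x S
    using that by (simp add: sum.If_cases Int_commute)
  have "(\<Sum>x\<in>A. card (N x \<inter> B)) = (\<Sum>x\<in>A. \<Sum>y\<in>B. if y \<in> N x then 1 else 0)"
    using assms(2) by (simp only: *)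
  also have "\<dots> = (\<Sum>y\<in>B. \<Sum>x\<in>A. if y \<in> N x then 1 else 0)"
    by (rule sum.swap)
  also have "\<dots> = (\<Sum>y\<in>B. \<Sum>x\<in>A. if x \<in> N y then 1 else 0)"
    using assms(3) by (intro sum.cong) auto
  also have "\<dots> = (\<Sum>y\<in>B. card (N y \<inter> A))"
    using assms(1) by (simp only: *)
  finally show ?thesis .
qed

text \<open>Ample regularity in terms of neighborhoods only: distance two becomes distinct,
  nonadjacent, with a common neighbor. Elements of the type that are not vertices fit in with empty
  neighborhoods.\<close>

locale ample_neighborhoods =
  fixes N :: "'a \<Rightarrow> 'a set" and \<alpha> \<beta> :: nat
  assumes finite_nbrs: "finite (N x)"
    and nbr_sym: "y \<in> N x \<Longrightarrow> x \<in> N y"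
    and adjacent_common: "y \<in> N x \<Longrightarrow> card (N x \<inter> N y) = \<alpha>"
    and nonadjacent_common:
      "x \<noteq> y \<Longrightarrow> y \<notin> N x \<Longrightarrow> N x \<inter> N y \<noteq> {} \<Longrightarrow> card (N x \<inter> N y) = \<beta>"
    and le: "\<alpha> \<le> \<beta>" and two_le: "2 \<le> \<alpha>"
begin

text \<open>The count is \<alpha> or \<beta> according to adjacency; as \<alpha> \<le> \<beta>, the
  bounds hold without knowing which.\<close>

lemma common_bounds:
  assumes "x \<noteq> y" "N x \<inter> N y \<noteq> {}"
  shows "\<alpha> \<le> card (N x \<inter> N y)" "card (N x \<inter> N y) \<le> \<beta>"
  using adjacent_common[of y x] nonadjacent_common[OF assms(1) _ assms(2)] le
  by (cases "y \<in> N x"; simp)+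

lemma finite_lower [simp]: "finite (lower N f x)"
  by (simp add: lower_def finite_nbrs)

lemma finite_upper [simp]: "finite (upper N f x)"
  by (simp add: upper_def finite_nbrs)

lemma common_level_two:
  fixes f :: "'a \<Rightarrow> int"
  assumes lip: "\<And>x y. y \<in> N x \<Longrightarrow> \<bar>f y - f x\<bar> \<le> 1"
    and "z \<in> N t" "m \<in> N z" "f m = f t + 2"
  shows "card (N t \<inter> N m) = \<beta>" "z \<in> N t \<inter> N m"
proof -
  show z: "z \<in> N t \<inter> N m"
    using assms(2) nbr_sym[OF assms(3)] by simp
  have "m \<notin> N t"
    using lip[of m t] assms(4) by auto
  moreover have "t \<noteq> m"
    using assms(4) by auto
  ultimately show "card (N t \<inter> N m) = \<beta>"
    using z by (intro nonadjacent_common) auto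
qed

lemma lower_growth:
  assumes lip: "\<And>x y. y \<in> N x \<Longrightarrow> \<bar>f y - f x\<bar> \<le> 1" and m: "m \<in> upper N f z"
  shows "card (lower N f z) * (\<beta> - 1) +
      (\<Sum>y\<in>lower N f m - {z}. card (N y \<inter> N z - lower N f z - {m}))
    \<le> (card (lower N f m) - 1) * (\<beta> - 1)"
proof -
  let ?L = "lower N f z" and ?M = "lower N f m - {z}"
  have mz: "m \<in> N z" "f m = f z + 1" "z \<in> lower N f m"
    using m by (auto simp: upper_def lower_def intro: nbr_sym)
  have "card (N t \<inter> ?M) = \<beta> - 1" if "t \<in> ?L" for t
  proof -
    have t: "z \<in> N t" "f m = f t + 2"
      using that mz by (auto simp: lower_def intro: nbr_sym)
    \<comment> \<open>A common neighbor of \<open>t\<close> and \<open>m\<close> is within one level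
      of both, hence on the level of \<open>z\<close>, and so a lower neighbor of
      \<open>m\<close>.\<close>
    have "f y = f z" if "y \<in> N t" "y \<in> N m" for y
      using lip[OF that(1)] lip[OF that(2)] t(2) mz(2) by linarith
    then have "N t \<inter> ?M = N t \<inter> N m - {z}"
      using mz by (auto simp: lower_def)
    then show ?thesis
      using common_level_two[OF lip t(1) mz(1) t(2)] finite_nbrs by (simp add: card_Diff_singleton)
  qed
  then have "card ?L * (\<beta> - 1) = (\<Sum>t\<in>?L. card (N t \<inter> ?M))"
    by simp
  also have "\<dots> = (\<Sum>y\<in>?M. card (N y \<inter> ?L))"
    by (rule sum_card_Int_swap) (auto intro: nbr_sym)
  finally have "card ?L * (\<beta> - 1) + (\<Sum>y\<in>?M. card (N y \<inter> N z - ?L - {m})) =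
      (\<Sum>y\<in>?M. card (N y \<inter> ?L) + card (N y \<inter> N z - ?L - {m}))"
    by (simp add: sum.distrib)
  also have "\<dots> \<le> (\<Sum>y\<in>?M. \<beta> - 1)"
  proof (rule sum_mono)
    \<comment> \<open>Since \<open>m\<close> is a common neighbor of \<open>y\<close> and
      \<open>z\<close> above \<open>z\<close>, it uses up one of at most \<beta> and lies in neither
      of the two sets counted here.\<close>
    fix y assume y: "y \<in> ?M"
    then have my: "m \<in> N y \<inter> N z"
      using mz by (auto simp: lower_def intro: nbr_sym)
    have "card (N y \<inter> ?L) + card (N y \<inter> N z - ?L - {m}) =
        card (N y \<inter> ?L \<union> (N y \<inter> N z - ?L - {m}))"
      using finite_nbrs by (intro card_Un_disjoint[symmetric]) auto
    also have "N y \<inter> ?L \<union> (N y \<inter> N z - ?L - {m}) = N y \<inter> N z - {m}"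
      using mz by (auto simp: lower_def)
    also have "card \<dots> = card (N y \<inter> N z) - 1"
      using my finite_nbrs by (simp add: card_Diff_singleton)
    also have "\<dots> \<le> \<beta> - 1"
      using common_bounds(2)[of y z] y my by (intro diff_le_mono) auto
    finally show "card (N y \<inter> ?L) + card (N y \<inter> N z - ?L - {m}) \<le> \<beta> - 1" .
  qed
  also have "\<dots> = (card (lower N f m) - 1) * (\<beta> - 1)"
    using mz by (simp add: card_Diff_singleton)
  finally show ?thesis .
qed

lemma upper_growth:
  assumes "\<And>x y. y \<in> N x \<Longrightarrow> \<bar>f y - f x\<bar> \<le> 1" and "m \<in> lower N f z"
  shows "card (upper N f z) * (\<beta> - 1) +
      (\<Sum>y\<in>upper N f m - {z}. card (N y \<inter> N z - upper N f z - {m}))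
    \<le> (card (upper N f m) - 1) * (\<beta> - 1)"
proof -
  have "\<bar>- f y - - f x\<bar> \<le> 1" if "y \<in> N x" for x y
    using assms(1)[OF that] by linarith
  moreover have "m \<in> upper N (\<lambda>x. - f x) z"
    using assms(2) by (auto simp: lower_def upper_def)
  ultimately show ?thesis
    using lower_growth[of "\<lambda>x. - f x"] by (simp add: lower_uminus)
qed

lemma two_step_growth:
  assumes lip: "\<And>x y. y \<in> N x \<Longrightarrow> \<bar>f y - f x\<bar> \<le> 1"
    and m: "m \<in> upper N f z" and m': "m' \<in> lower N f z"
  shows "card (lower N f z) + card (upper N f z) + \<alpha> \<le> card (lower N f m) + card (upper N f m')"
proof -
  define S where "S = N m' \<inter> N m - {z}"
  let ?a = "\<lambda>y. card (N y \<inter> N z - lower N f z - {m})"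
  let ?b = "\<lambda>y. card (N y \<inter> N z - upper N f z - {m'})"
  have mz: "z \<in> N m'" "m \<in> N z" "f m = f m' + 2" "f m = f z + 1" "f m' = f z - 1"
      "z \<in> lower N f m" "z \<in> upper N f m'"
    using m m' by (auto simp: upper_def lower_def intro: nbr_sym)
  note common = common_level_two[OF lip mz(1-3)]
  have level: "f y = f z" if "y \<in> N m'" "y \<in> N m" for y
    using lip[OF that(1)] lip[OF that(2)] mz(4,5) by linarith
  have S: "S \<subseteq> lower N f m - {z}" "S \<subseteq> upper N f m' - {z}"
  proof -
    have "y \<in> lower N f m \<and> y \<in> upper N f m' \<and> y \<noteq> z" if "y \<in> S" for y
      using that level[of y] mz(4,5) by (simp add: S_def lower_def upper_def)
    then show "S \<subseteq> lower N f m - {z}" "S \<subseteq> upper N f m' - {z}"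
      by auto
  qed
  have cS: "card S = \<beta> - 1"
    using common finite_nbrs by (simp add: S_def card_Diff_singleton)
  have "(\<beta> - 1) * (\<alpha> - 2) = (\<Sum>y\<in>S. \<alpha> - 2)"
    by (simp add: cS)
  also have "\<dots> \<le> (\<Sum>y\<in>S. ?a y + ?b y)"
  proof (rule sum_mono)
    fix y assume y: "y \<in> S"
    then have "m \<in> N y \<inter> N z" "y \<noteq> z"
      using mz by (auto simp: S_def intro: nbr_sym)
    then have "\<alpha> \<le> card (N y \<inter> N z)"
      by (intro common_bounds) auto
    moreover have "card {m, m'} \<le> 2"
      by (simp add: card_insert_if)
    ultimately have "\<alpha> - 2 \<le> card (N y \<inter> N z) - card {m, m'}"
      by linarith
    also have "\<dots> \<le> card (N y \<inter> N z - {m, m'})"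
      by (rule diff_card_le_card_Diff) simp
    \<comment> \<open>No vertex is both below and above \<open>z\<close>, so each common neighbor
      other than \<open>m\<close> and \<open>m'\<close> is counted on at least one side.\<close>
    also have "\<dots> \<le> card ((N y \<inter> N z - lower N f z - {m}) \<union> (N y \<inter> N z - upper N f z - {m'}))"
      using finite_nbrs by (intro card_mono) (auto simp: lower_def upper_def)
    also have "\<dots> \<le> ?a y + ?b y"
      by (rule card_Un_le)
    finally show "\<alpha> - 2 \<le> ?a y + ?b y" .
  qed
  also have "\<dots> \<le> sum ?a (lower N f m - {z}) + sum ?b (upper N f m' - {z})"
    unfolding sum.distrib using S by (intro add_mono sum_mono2) auto
  \<comment> \<open>Adding the two growth inequalities leaves the factor \<beta> - 1 in every term;
    it is positive because \<beta> \<ge> \<alpha> \<ge> 2.\<close>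
  finally have "(card (lower N f z) + card (upper N f z) + (\<alpha> - 2)) * (\<beta> - 1)
      \<le> ((card (lower N f m) - 1) + (card (upper N f m') - 1)) * (\<beta> - 1)"
    using lower_growth[OF lip m] upper_growth[OF lip m'] by (simp add: algebra_simps)
  then have "card (lower N f z) + card (upper N f z) + (\<alpha> - 2)
      \<le> (card (lower N f m) - 1) + (card (upper N f m') - 1)"
    using le two_le by simp
  \<comment> \<open>Both sets contain \<open>z\<close>, so the truncated subtractions are exact, and
    their two units turn \<alpha> - 2 into \<alpha>.\<close>
  moreover have "card (lower N f m) > 0" "card (upper N f m') > 0"
    using mz by (auto simp: card_gt_0_iff)
  ultimately show ?thesis
    using two_le by linarith
qed

lemma ascending_path_bound:
  assumes lip: "\<And>x y. y \<in> N x \<Longrightarrow> \<bar>f y - f x\<bar> \<le> 1"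
    and deg: "\<And>x. card (N x) \<le> d"
    and path: "\<And>i. i < D \<Longrightarrow> p (Suc i) \<in> upper N f (p i)"
  shows "(D - 1) * \<alpha> \<le> 2 * d"
proof (cases D)
  case (Suc k)
  \<comment> \<open>Telescoping invariant: each inner vertex \<open>p (Suc i)\<close>, taken as
    \<open>z\<close> in \<open>two_step_growth\<close> between \<open>p i\<close> and
    \<open>p (Suc (Suc i))\<close>, contributes one \<alpha>.\<close>
  have "i * \<alpha> + card (lower N f (p 1)) + card (upper N f (p i))
      \<le> card (lower N f (p (Suc i))) + card (upper N f (p 0))" if "i < D" for i
    using that
  proof (induction i)
    case (Suc i)
    have "p (Suc (Suc i)) \<in> upper N f (p (Suc i))" "p i \<in> lower N f (p (Suc i))"
      using path[of "Suc i"] path[of i] Suc.prems by (auto simp: upper_def lower_def intro: nbr_sym)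
    from two_step_growth[OF lip this] Suc show ?case
      by simp
  qed simp
  from this[of k] Suc have "k * \<alpha> \<le> card (lower N f (p (Suc k))) + card (upper N f (p 0))"
    by simp
  also have "\<dots> \<le> card (N (p (Suc k))) + card (N (p 0))"
    using finite_nbrs by (intro add_mono card_mono) (auto simp: lower_def upper_def)
  also have "\<dots> \<le> 2 * d"
    using deg[of "p (Suc k)"] deg[of "p 0"] by simp
  finally show ?thesis
    by (simp add: Suc)
qed simp

end

section \<open>Graph distance\<close>

lemma (in pair_wf_digraph) relpow_iff_awalk:
  assumes "u \<in> pverts G"
  shows "(u, v) \<in> parcs G ^^ n \<longleftrightarrow> (\<exists>p. awalk u p v \<and> length p = n)"
  using assms
proof (induction n arbitrary: u)
  case 0
  then show ?case
    by (auto simp: awalk_Nil_iff)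
next
  case (Suc n)
  have "(u, v) \<in> parcs G ^^ Suc n \<longleftrightarrow> (\<exists>w. (u, w) \<in> parcs G \<and> (w, v) \<in> parcs G ^^ n)"
    by (meson relpow_Suc_E2 relpow_Suc_I2)
  also have "\<dots> \<longleftrightarrow> (\<exists>w p. (u, w) \<in> parcs G \<and> awalk w p v \<and> length p = n)"
    using Suc.IH in_arcsD2 by blast
  also have "\<dots> \<longleftrightarrow> (\<exists>p. awalk u p v \<and> length p = Suc n)"
  proof
    assume "\<exists>w p. (u, w) \<in> parcs G \<and> awalk w p v \<and> length p = n"
    then obtain w p where "(u, w) \<in> parcs G" "awalk w p v" "length p = n"
      by blast
    then have "awalk u ((u, w) # p) v \<and> length ((u, w) # p) = Suc n"
      by (simp add: awalk_Cons_iff)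
    then show "\<exists>p. awalk u p v \<and> length p = Suc n" ..
  qed (fastforce simp: length_Suc_conv awalk_Cons_iff)
  finally show ?case .
qed

lemma (in wf_digraph) awalk_cost_unit: "awalk_cost (\<lambda>_. 1) p = real (length p)"
  by (induction p) simp_all

text \<open>The infimum over all walks is attained by a shortest one, which exists because some walk
  of length \<open>k\<close> does.\<close>

lemma graph_dist_eq_Least:
  assumes "pair_wf_digraph G" "u \<in> pverts G" "(u, v) \<in> parcs G ^^ k"
  shows "graph_dist G u v = ereal (real (LEAST n. (u, v) \<in> parcs G ^^ n))"
proof -
  interpret pair_wf_digraph G by fact
  let ?n = "LEAST n. (u, v) \<in> parcs G ^^ n"
  have "(u, v) \<in> parcs G ^^ ?n"
    using assms(3) by (rule LeastI)
  then obtain p where p: "awalk u p v" "length p = ?n"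
    using relpow_iff_awalk[OF assms(2)] by blast
  have "?n \<le> length q" if "awalk u q v" for q
    using that relpow_iff_awalk[OF assms(2)] by (auto intro: Least_le)
  then show ?thesis
    unfolding graph_dist_def \<mu>_def using p
    by (intro antisym INF_lower2[of p] INF_greatest) (auto simp: awalk_cost_unit)
qed

lemma graph_dist_two:
  assumes "pair_wf_digraph G" "(u, w) \<in> parcs G" "(w, v) \<in> parcs G" "u \<noteq> v" "(u, v) \<notin> parcs G"
  shows "graph_dist G u v = 2"
proof -
  have 2: "(u, v) \<in> parcs G ^^ 2"
    using assms(2,3) by (auto simp: numeral_2_eq_2)
  have "(LEAST n. (u, v) \<in> parcs G ^^ n) = 2"
  proof (rule Least_equality, rule 2)
    fix n assume n: "(u, v) \<in> parcs G ^^ n"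
    show "2 \<le> n"
    proof (rule ccontr)
      assume "\<not> 2 \<le> n"
      then have "n = 0 \<or> n = 1"
        by auto
      then show False
        using n assms(4,5) by auto
    qed
  qed
  then show ?thesis
    using graph_dist_eq_Least[OF assms(1) _ 2] pair_wf_digraph.in_arcsD1[OF assms(1,2)] by simp
qed

section \<open>From geodesics to the diameter bound\<close>

theorem corollary1p4:
  fixes G :: "'a pair_pre_digraph" and n :: enat and d \<alpha> \<beta> :: nat and \<epsilon> :: real
  assumes "amply_regular G n d \<alpha> \<beta>"
    and "Digraph_Component.connected (with_proj G)"
    and "\<not> complete_graph G" and "\<not> empty_graph G"
    and "0 < \<epsilon>" and "\<epsilon> < 1"
    and "\<beta> \<ge> \<alpha>" and "real \<alpha> > \<epsilon> * real d" and "\<epsilon> * real d \<ge> 1"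
  shows "graph_diameter G \<le> ereal (4 / \<epsilon>)"
proof -
  interpret pair_bidirected_digraph G
    using assms(1) by (simp add: amply_regular_def)
  let ?N = "\<lambda>x. {y. (x, y) \<in> parcs G}"
  have wf: "pair_wf_digraph G" ..
  have sym: "(y, x) \<in> parcs G" if "(x, y) \<in> parcs G" for x y
    using that by (simp add: arcs_symmetric)
  \<comment> \<open>Degrees count arcs; the injection \<open>Pair x\<close> turns them into counts
    of neighbors.\<close>
  have out: "out_arcs (with_proj G) x = Pair x ` ?N x" for x
    by (auto simp: out_arcs_def)
  have inj: "inj_on (Pair x) A" for x :: 'a and A :: "'a set"
    by (auto simp: inj_on_def)
  have deg: "finite (?N x) \<and> card (?N x) \<le> d" for x
  proof (cases "x \<in> pverts G")
    case True
    then have "finite (out_arcs (with_proj G) x)" "card (out_arcs (with_proj G) x) = d"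
      using assms(1) by (auto simp: amply_regular_def regular_graph_def out_degree_def)
    then show ?thesis
      unfolding out by (simp add: finite_image_iff[OF inj] card_image[OF inj])
  next
    case False
    then have "?N x = {}"
      using in_arcsD1 by blast
    then show ?thesis
      by simp
  qed
  have common: "common_neighbors G x y = ?N x \<inter> ?N y" for x y
    using in_arcsD2 by (auto simp: common_neighbors_def)
  \<comment> \<open>As \<alpha> is an integer, this gives \<alpha> \<ge> 2.\<close>
  have "1 < real \<alpha>"
    using assms(8,9) by linarith
  interpret ample_neighborhoods ?N \<alpha> \<beta>
  proof
    show "card (?N x \<inter> ?N y) = \<alpha>" if "y \<in> ?N x" for x y
      using that assms(1) in_arcsD1 in_arcsD2 unfolding common[symmetric] amply_regular_def by blast
    show "card (?N x \<inter> ?N y) = \<beta>" if "x \<noteq> y" "y \<notin> ?N x" "?N x \<inter> ?N y \<noteq> {}" for x y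
    proof -
      obtain w where w: "(x, w) \<in> parcs G" "(w, y) \<in> parcs G"
        using \<open>?N x \<inter> ?N y \<noteq> {}\<close> sym by blast
      then have "graph_dist G x y = 2"
        using that by (intro graph_dist_two[OF wf]) auto
      then show ?thesis
        using w assms(1) in_arcsD1 in_arcsD2 unfolding common[symmetric] amply_regular_def by blast
    qed
  qed (use deg \<open>\<alpha> \<le> \<beta>\<close> \<open>1 < real \<alpha>\<close> in \<open>auto intro: sym\<close>)
  have "graph_dist G u v \<le> ereal (4 / \<epsilon>)" if u: "u \<in> pverts G" and v: "v \<in> pverts G" for u v
  proof -
    \<comment> \<open>The distance from \<open>u\<close> as a natural number, meaningful at every
      vertex by connectedness.\<close>
    define \<delta> where "\<delta> x = (LEAST n. (u, x) \<in> parcs G ^^ n)" for x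
    have reach: "(u, x) \<in> parcs G ^^ \<delta> x" if x: "x \<in> pverts G" for x
    proof -
      have "strongly_connected (with_proj G)"
        using assms(2) symmetric_connected_imp_strongly_connected sym_arcs by blast
      then have "u \<rightarrow>\<^sup>*\<^bsub>with_proj G\<^esub> x"
        using u x by auto
      then obtain k where "(u, x) \<in> parcs G ^^ k"
        using relpow_iff_awalk[OF u] by (auto simp: reachable_awalk)
      then show ?thesis
        unfolding \<delta>_def by (rule LeastI)
    qed
    have step: "\<delta> y \<le> Suc (\<delta> x)" if "(x, y) \<in> parcs G" for x y
      using relpow_Suc_I[OF reach[OF in_arcsD1[OF that]] that] unfolding \<delta>_def[of y] by (rule Least_le)
    have lip: "\<bar>int (\<delta> y) - int (\<delta> x)\<bar> \<le> 1" if "y \<in> ?N x" for x y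
      using step[of x y] step[of y x] sym[of x y] that by force
    define D where "D = \<delta> v"
    obtain p where p: "p 0 = u" "p D = v" "\<And>i. i < D \<Longrightarrow> (p i, p (Suc i)) \<in> parcs G"
      using reach[OF v] unfolding D_def relpow_fun_conv by blast
    have "\<delta> u = 0"
      unfolding \<delta>_def by (rule Least_eq_0) simp
    have up: "\<delta> (p i) \<le> i" if "i \<le> D" for i
      using that
    proof (induction i)
      case 0
      then show ?case
        using p(1) \<open>\<delta> u = 0\<close> by simp
    next
      case (Suc i)
      then show ?case
        using step[OF p(3)[of i]] by simp
    qed
    have down: "D \<le> \<delta> (p i) + (D - i)" if "i \<le> D" for i
      using that
    proof (induction rule: inc_induct)
      case base
      then show ?case
        using p(2) by (simp add: D_def)
    next
      case (step i)
      then show ?case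
        using \<open>\<And>x y. (x, y) \<in> parcs G \<Longrightarrow> \<delta> y \<le> Suc (\<delta> x)\<close>[OF p(3)[of i]] by simp
    qed
    \<comment> \<open>Levels rise by at most one per arc: counted from \<open>u\<close> this bounds
      \<open>\<delta> (p i)\<close> by \<open>i\<close> from above, counted back from
      \<open>v\<close> from below.\<close>
    have level: "\<delta> (p i) = i" if "i \<le> D" for i
      using up[OF that] down[OF that] that by simp
    have "(D - 1) * \<alpha> \<le> 2 * d"
    proof (rule ascending_path_bound[where f = "\<lambda>x. int (\<delta> x)" and p = p])
      show "p (Suc i) \<in> upper ?N (\<lambda>x. int (\<delta> x)) (p i)" if "i < D" for i
        using that p(3) level[of i] level[of "Suc i"] by (simp add: upper_def)
    qed (use lip deg in auto)
    then have "real (D - 1) * real \<alpha> \<le> 2 * real d"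
      by (metis of_nat_le_iff of_nat_mult of_nat_numeral)
    moreover have "real (D - 1) * (\<epsilon> * real d) \<le> real (D - 1) * real \<alpha>"
      using assms(8) by (intro mult_left_mono) auto
    ultimately have "(real (D - 1) * \<epsilon>) * real d \<le> 2 * real d"
      by (simp add: mult.assoc)
    moreover have "real d > 0"
      using assms(9) by (cases d) auto
    ultimately have "real (D - 1) * \<epsilon> \<le> 2"
      by simp
    \<comment> \<open>An inequality only, since \<open>D - 1\<close> is 0 for \<open>D = 0\<close>.
      It gives D \<epsilon> \<le> 2 + \<epsilon> < 4.\<close>
    moreover have "real D \<le> real (D - 1) + 1"
      by simp
    then have "real D * \<epsilon> \<le> (real (D - 1) + 1) * \<epsilon>"
      using assms(5) by (intro mult_right_mono) auto
    ultimately have "real D * \<epsilon> \<le> 4"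
      using assms(6) by (simp add: distrib_right)
    then have "real D \<le> 4 / \<epsilon>"
      using assms(5) by (simp add: pos_le_divide_eq)
    then show ?thesis
      using graph_dist_eq_Least[OF wf u reach[OF v]] by (simp add: D_def \<delta>_def)
  qed
  then show ?thesis
    unfolding graph_diameter_def by (intro SUP_least)
qed

end
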